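(* Let $\alpha,\beta,\gamma,\delta$ be positive real numbers with $-\delta<-\gamma<-1<1<\alpha<\beta$. Then $$\mathsf{NORM}_{-\delta}\subset\mathsf{NORM}_{-\gamma}\subset\mathsf{NORM}\supset\mathsf{NORM}_{\alpha}\supset\mathsf{NORM}_{\beta}$$ (inclusions not claimed to be proper).
   Context: Let $\mathsf{NORM}$ be the class of all real normed vector spaces. Let $(X,\|\cdot\|)\in\mathsf{NORM}$ and $\varrho\in\mathbb{R}$. For $\vec x,\vec y\in X\setminus\{\vec 0\}$ put $\mathbf{s}=\left\|\frac{\vec x}{\|\vec x\|}+\frac{\vec y}{\|\vec y\|}\right\|$, $\mathbf{d}=\left\|\frac{\vec x}{\|\vec x\|}-\frac{\vec y}{\|\vec y\|}\right\|$, $\mathbf{\Sigma}=\mathbf{s}^2+\mathbf{d}^2$ (which is $>0$), $\mathbf{\Delta}=\mathbf{s}^2-\mathbf{d}^2$, and $\langle\vec x\,|\,\vec y\rangle_\varrho=\|\vec x\|\cdot\|\vec y\|\cdot\frac14\mathbf{\Delta}\cdot\left(\frac14\mathbf{\Sigma}\right)^{\varrho}$; put $\langle\vec x\,|\,\vec y\rangle_\varrho=0$ if $\vec x=\vec 0$ or $\vec y=\vec 0$. The space $(X,\|\cdot\|)$ "has the angle $\angle_\varrho$" if $|\langle\vec x\,|\,\vec y\rangle_\varrho|\le\|\vec x\|\cdot\|\vec y\|$ for all $\vec x,\vec y\in X$, i.e. if the angle $\angle_\varrho(\vec x,\vec y):=\arccos\frac{\langle\vec x|\vec y\rangle_\varrho}{\|\vec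 x\|\|\vec y\|}$ is defined for all $\vec x,\vec y\ne\vec 0$. $\mathsf{NORM}_\varrho$ is the class of all real normed vector spaces that have the angle $\angle_\varrho$. *)

theory Defs
  imports Complex_Main
begin

text \<open>
  A real normed space is a pair of a linear subspace \<open>X\<close> of an ambient real vector space and a
  norm \<open>N\<close> on \<open>X\<close>. With \<open>X = UNIV\<close> this is a norm on the whole of an arbitrary real vector space.
  Having the norm as a term, rather than as the fixed norm of a type, makes classes of normed
  spaces sets that can be compared by inclusion. The values of \<open>N\<close> outside \<open>X\<close> are irrelevant.
\<close>

type_synonym 'a nspace = "'a set \<times> ('a \<Rightarrow> real)"

definition is_norm_on :: "'a::real_vector set \<Rightarrow> ('a \<Rightarrow> real) \<Rightarrow> bool" where
  "is_norm_on X N \<longleftrightarrow>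
     (\<forall>x\<in>X. 0 \<le> N x) \<and>
     (\<forall>x\<in>X. N x = 0 \<longleftrightarrow> x = 0) \<and>
     (\<forall>a. \<forall>x\<in>X. N (a *\<^sub>R x) = \<bar>a\<bar> * N x) \<and>
     (\<forall>x\<in>X. \<forall>y\<in>X. N (x + y) \<le> N x + N y)"

definition NORM :: "'a::real_vector nspace set" where
  "NORM = {(X, N). subspace X \<and> is_norm_on X N}"

definition s_val :: "('a::real_vector \<Rightarrow> real) \<Rightarrow> 'a \<Rightarrow> 'a \<Rightarrow> real" where
  "s_val N x y = N (x /\<^sub>R N x + y /\<^sub>R N y)"

definition d_val :: "('a::real_vector \<Rightarrow> real) \<Rightarrow> 'a \<Rightarrow> 'a \<Rightarrow> real" where
  "d_val N x y = N (x /\<^sub>R N x - y /\<^sub>R N y)"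

definition Sigma_val :: "('a::real_vector \<Rightarrow> real) \<Rightarrow> 'a \<Rightarrow> 'a \<Rightarrow> real" where
  "Sigma_val N x y = (s_val N x y)\<^sup>2 + (d_val N x y)\<^sup>2"

definition Delta_val :: "('a::real_vector \<Rightarrow> real) \<Rightarrow> 'a \<Rightarrow> 'a \<Rightarrow> real" where
  "Delta_val N x y = (s_val N x y)\<^sup>2 - (d_val N x y)\<^sup>2"

definition rho_product :: "real \<Rightarrow> ('a::real_vector \<Rightarrow> real) \<Rightarrow> 'a \<Rightarrow> 'a \<Rightarrow> real" where
  "rho_product \<rho> N x y =
     (if x = 0 \<or> y = 0 then 0
      else N x * N y * (1/4 * Delta_val N x y) * (1/4 * Sigma_val N x y) powr \<rho>)"

definition has_angle :: "real \<Rightarrow> 'a::real_vector nspace \<Rightarrow> bool" where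
  "has_angle \<rho> = (\<lambda>(X, N). \<forall>x\<in>X. \<forall>y\<in>X. \<bar>rho_product \<rho> N x y\<bar> \<le> N x * N y)"

definition NORM_angle :: "real \<Rightarrow> 'a::real_vector nspace set" where
  "NORM_angle \<rho> = {S \<in> NORM. has_angle \<rho> S}"

text \<open>
  Agreement with the library's normed spaces: a norm on a whole type is exactly one that makes the
  type an instance of \<open>real_normed_vector\<close> (the other operations of that class are
  determined by the norm).
\<close>

lemma NORM_UNIV_norm: "(UNIV :: 'a::real_normed_vector set, norm) \<in> NORM"
  by (auto simp: NORM_def is_norm_on_def norm_triangle_ineq)

lemma NORM_UNIV_iff:
  fixes N :: "'a::real_vector \<Rightarrow> real"
  defines "U \<equiv> INF e\<in>{0<..}. principal {(x, y). N (x - y) < e}"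
  shows "(UNIV, N) \<in> NORM \<longleftrightarrow>
    class.real_normed_vector (-) (\<lambda>x y. N (x - y)) N (+) 0 uminus (*\<^sub>R)
      (\<lambda>x. x /\<^sub>R N x) U (\<lambda>V. \<forall>x\<in>V. eventually (\<lambda>(x', y). x' = x \<longrightarrow> y \<in> V) U)"
    (is "?L \<longleftrightarrow> ?R")
proof -
  have nonneg: "0 \<le> N x" if "N 0 = 0" "\<And>x y. N (x + y) \<le> N x + N y"
    "\<And>a x. N (a *\<^sub>R x) = \<bar>a\<bar> * N x" for x
    using that(1) that(2)[of x "- x"] that(3)[of "-1" x] by simp
  have rv: "class.real_vector (+) (0::'a) (-) uminus (*\<^sub>R)"
    by (rule real_vector_class.real_vector_axioms)
  show ?thesis
    unfolding class.real_normed_vector_def class.real_normed_vector_axioms_def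
      class.dist_norm_def class.sgn_div_norm_def class.uniformity_dist_def
      class.open_uniformity_def NORM_def is_norm_on_def U_def
    using nonneg rv by auto
qed

end

theory Submission
  imports Defs
begin

text \<open>
  For unit vectors write \<open>\<sigma> = \<Sigma>/4\<close> and \<open>\<tau> = \<Delta>/4\<close>. Having the angle \<open>\<rho>\<close> means
  \<open>\<bar>\<tau>\<bar> \<sigma>\<^sup>\<rho> \<le> 1\<close> throughout. The value \<open>\<rho> = - 1\<close> is special: \<open>\<bar>\<tau>\<bar> \<le> \<sigma>\<close> always holds, since a
  difference of two squares is at most their sum, so every normed space has the angle \<open>- 1\<close>.
  As \<open>\<rho> \<mapsto> \<sigma>\<^sup>\<rho>\<close> is monotone (increasing or decreasing according to \<open>\<sigma>\<close>), its value at an exponent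
  between \<open>- 1\<close> and \<open>\<rho>\<close> never exceeds the larger of its two values at the ends. Hence the
  angle condition at \<open>\<rho>\<close> passes to every exponent between \<open>- 1\<close> and \<open>\<rho>\<close>, on either side of
  \<open>- 1\<close> (\<open>NORM_angle_antimono_from_minus_one\<close>), and both chains of inclusions are
  instances of this.
\<close>

lemma powr_le_max_of_between:
  fixes s p q r :: real
  assumes "0 \<le> s" and "p \<le> q \<and> q \<le> r \<or> r \<le> q \<and> q \<le> p"
  shows "s powr q \<le> max (s powr p) (s powr r)"
proof (cases "s \<le> 1")
  case True
  with assms show ?thesis by (auto simp: le_max_iff_disj intro: powr_mono')
next
  case False
  with assms show ?thesis by (auto simp: le_max_iff_disj intro: powr_mono)
qed

lemma mult_powr_le_one_of_between_minus_one:
  fixes s t :: real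
  assumes "0 \<le> s" and "\<bar>t\<bar> \<le> s"
    and "- 1 \<le> q \<and> q \<le> r \<or> r \<le> q \<and> q \<le> - 1"
    and "\<bar>t\<bar> * s powr r \<le> 1"
  shows "\<bar>t\<bar> * s powr q \<le> 1"
proof -
  \<comment> \<open>If \<open>s = 0\<close> then \<open>t = 0\<close>; otherwise the left side is \<open>\<bar>t\<bar> / s\<close>.\<close>
  have end_minus_one: "\<bar>t\<bar> * s powr (- 1) \<le> 1"
    using assms(1,2) by (cases "s = 0") (auto simp: powr_minus field_simps)
  have "\<bar>t\<bar> * s powr q \<le> \<bar>t\<bar> * max (s powr (- 1)) (s powr r)"
    using powr_le_max_of_between[OF assms(1,3)] by (intro mult_left_mono) auto
  also have "\<dots> \<le> 1"
    using end_minus_one assms(4) by (simp add: max_def)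
  finally show ?thesis .
qed

text \<open>
  The factors \<open>N x\<close> and \<open>N y\<close> cancel, so the angle condition becomes one about the two numbers
  \<open>\<Delta>/4\<close> and \<open>\<Sigma>/4\<close> only.
\<close>

lemma rho_product_bound_iff:
  assumes "is_norm_on X N" and "x \<in> X" and "y \<in> X" and "x \<noteq> 0" and "y \<noteq> 0"
  shows "\<bar>rho_product r N x y\<bar> \<le> N x * N y \<longleftrightarrow>
    \<bar>1/4 * Delta_val N x y\<bar> * (1/4 * Sigma_val N x y) powr r \<le> 1"
proof -
  have pos: "0 < N x" "0 < N y"
    using assms by (auto simp: is_norm_on_def less_le)
  let ?c = "\<bar>1/4 * Delta_val N x y\<bar> * (1/4 * Sigma_val N x y) powr r"
  have "\<bar>rho_product r N x y\<bar> = N x * N y * ?c"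
    using pos assms(4,5) by (simp add: rho_product_def abs_mult)
  moreover have "N x * N y * ?c \<le> N x * N y * 1 \<longleftrightarrow> ?c \<le> 1"
    using pos by (intro mult_le_cancel_left_pos) simp
  ultimately show ?thesis by (simp only: mult_1_right)
qed

theorem NORM_angle_antimono_from_minus_one:
  assumes "- 1 \<le> q \<and> q \<le> r \<or> r \<le> q \<and> q \<le> - 1"
  shows "(NORM_angle r :: 'a::real_vector nspace set) \<subseteq> NORM_angle q"
proof
  fix S :: "'a nspace"
  assume S: "S \<in> NORM_angle r"
  obtain X N where XN: "S = (X, N)" by (cases S)
  from S have norm: "is_norm_on X N" and "has_angle r (X, N)" and "S \<in> NORM"
    by (auto simp: NORM_angle_def NORM_def XN)
  have "\<bar>rho_product q N x y\<bar> \<le> N x * N y" if "x \<in> X" "y \<in> X" for x y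
  proof (cases "x = 0 \<or> y = 0")
    case True
    with norm that show ?thesis by (auto simp: rho_product_def is_norm_on_def)
  next
    case False
    have "\<bar>rho_product r N x y\<bar> \<le> N x * N y"
      using \<open>has_angle r (X, N)\<close> that by (simp add: has_angle_def)
    moreover have "0 \<le> 1/4 * Sigma_val N x y"
      by (simp add: Sigma_val_def)
    moreover have "\<bar>1/4 * Delta_val N x y\<bar> \<le> 1/4 * Sigma_val N x y"
      by (simp add: Sigma_val_def Delta_val_def abs_le_iff)
    ultimately show ?thesis
      using mult_powr_le_one_of_between_minus_one[OF _ _ assms]
        rho_product_bound_iff[OF norm that] False by blast
  qed
  with \<open>S \<in> NORM\<close> show "S \<in> NORM_angle q"
    by (simp add: NORM_angle_def has_angle_def XN)
qed

theorem corollary2: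
  fixes \<alpha> \<beta> \<gamma> \<delta> :: real
  assumes "\<alpha> > 0" and "\<beta> > 0" and "\<gamma> > 0" and "\<delta> > 0"
    and "- \<delta> < - \<gamma>" and "- \<gamma> < - 1" and "(1::real) < \<alpha>" and "\<alpha> < \<beta>"
  shows "(NORM_angle (- \<delta>) :: 'a::real_vector nspace set) \<subseteq> NORM_angle (- \<gamma>)
    \<and> (NORM_angle (- \<gamma>) :: 'a nspace set) \<subseteq> NORM
    \<and> (NORM :: 'a nspace set) \<supseteq> NORM_angle \<alpha>
    \<and> (NORM_angle \<alpha> :: 'a nspace set) \<supseteq> NORM_angle \<beta>"
proof (intro conjI)
  show "(NORM_angle (- \<delta>) :: 'a nspace set) \<subseteq> NORM_angle (- \<gamma>)"
    using assms by (intro NORM_angle_antimono_from_minus_one) simp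
  show "(NORM_angle \<beta> :: 'a nspace set) \<subseteq> NORM_angle \<alpha>"
    using assms by (intro NORM_angle_antimono_from_minus_one) simp
qed (auto simp: NORM_angle_def)

end
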